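(* Let $L:\mathbb{R}^d\to\mathbb{R}^d$ be a linear map with matrix $[L_{ij}]$ in the standard basis, and let $u=(u_1,\dots,u_d)$ be its high frequency landscape vector, $u_i=\sum_{j=1}^d|L_{ij}|$. Let $\phi=(\phi_1,\dots,\phi_d)^T\in\mathbb{R}^d$ be an eigenvector of $L$ corresponding to an eigenvalue $\lambda>0$, normalized such that $\max_{1\le i\le d}|\phi_i|=1$. Then for each $i=1,\dots,d$, $$\phi_i\le\frac1\lambda u_i.$$
   Context: For a linear map $L$ on $\mathbb{R}^d$ with matrix $[L_{ij}]$, $|L|$ denotes the linear map with matrix $[|L_{ij}|]$, and the high frequency landscape vector is $u=|L|(1,\dots,1)^T$. *)

theory Defs
  imports "HOL-Analysis.Analysis"
begin

definition abs_linear_map :: "(real ^ 'n \<Rightarrow> real ^ 'n) \<Rightarrow> real ^ 'n \<Rightarrow> real ^ 'n::finite" where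
  "abs_linear_map L = (\<lambda>x. map_matrix abs (matrix L) *v x)"

definition high_freq_landscape :: "(real ^ 'n \<Rightarrow> real ^ 'n) \<Rightarrow> real ^ 'n::finite" where
  "high_freq_landscape L = abs_linear_map L (\<chi> i. 1)"

definition is_eigenvector :: "('a::real_vector \<Rightarrow> 'a) \<Rightarrow> 'a \<Rightarrow> real \<Rightarrow> bool" where
  "is_eigenvector L v \<mu> \<longleftrightarrow> v \<noteq> 0 \<and> L v = \<mu> *\<^sub>R v"

lemma high_freq_landscape_nth:
  "high_freq_landscape L $ i = (\<Sum>j\<in>UNIV. \<bar>matrix L $ i $ j\<bar>)"
  by (simp add: high_freq_landscape_def abs_linear_map_def matrix_vector_mult_def)

end

theory Submission
  imports Defs
begin

text \<open>
  The landscape vector is the sharp entrywise bound for the image under \<open>L\<close> of the unit ball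
  of the sup norm: its \<open>i\<close>-th entry is the \<open>\<ell>\<^sup>1\<close> norm of the \<open>i\<close>-th row of the matrix, and
  \<open>\<ell>\<^sup>1\<close> is the norm dual to the sup norm (\<open>abs_nth_le_high_freq_landscape\<close>). A normalized
  eigenvector lies in that ball, and its image is \<open>\<mu>\<close> times itself, so dividing the bound
  by \<open>\<mu> > 0\<close> gives the claim.
\<close>

lemma abs_nth_le_high_freq_landscape:
  fixes L :: "real ^ 'd \<Rightarrow> real ^ 'd::finite"
  assumes "linear L" and bound: "\<And>j. \<bar>x $ j\<bar> \<le> M"
  shows "\<bar>L x $ i\<bar> \<le> M * high_freq_landscape L $ i"
proof -
  have "L x $ i = (\<Sum>j\<in>UNIV. matrix L $ i $ j * x $ j)"
    using fun_cong[OF matrix_vector_mul(2)[OF \<open>linear L\<close>], of x]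
    by (simp add: matrix_vector_mult_def vec_eq_iff)
  then have "\<bar>L x $ i\<bar> \<le> (\<Sum>j\<in>UNIV. \<bar>matrix L $ i $ j * x $ j\<bar>)"
    by simp
  also have "\<dots> \<le> (\<Sum>j\<in>UNIV. \<bar>matrix L $ i $ j\<bar> * M)"
    unfolding abs_mult by (intro sum_mono mult_left_mono bound) simp
  also have "\<dots> = M * high_freq_landscape L $ i"
    by (simp add: high_freq_landscape_nth sum_distrib_left mult.commute)
  finally show ?thesis .
qed

theorem theorem6p2:
  fixes L :: "real ^ 'd \<Rightarrow> real ^ 'd::finite"
    and \<phi> :: "real ^ 'd"
    and \<mu> :: real
  assumes "linear L"
    and "is_eigenvector L \<phi> \<mu>"
    and "\<mu> > 0"
    and "Max (range (\<lambda>i. \<bar>\<phi> $ i\<bar>)) = 1"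
  shows "\<forall>i. \<phi> $ i \<le> (1 / \<mu>) * high_freq_landscape L $ i"
proof
  fix i
  have "\<bar>\<phi> $ j\<bar> \<le> 1" for j
    using assms(4) by (metis Max_ge finite finite_imageI rangeI)
  then have "\<bar>L \<phi> $ i\<bar> \<le> 1 * high_freq_landscape L $ i"
    by (rule abs_nth_le_high_freq_landscape[OF \<open>linear L\<close>])
  moreover have "L \<phi> $ i = \<mu> * \<phi> $ i"
    using assms(2) by (simp add: is_eigenvector_def)
  ultimately show "\<phi> $ i \<le> (1 / \<mu>) * high_freq_landscape L $ i"
    using \<open>\<mu> > 0\<close> by (simp add: field_simps)
qed

end
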